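(* Let $N\ge 2$ and let $\mathbf{L}$ be the combinatorial Laplacian of the path graph $P_N$ with vertices $1,\dots,N$ and edges $\{i,i+1\}$ for $1\le i\le N-1$. For $1\le k\le N$ set $$\lambda_k=2\left(1-\cos\left(\frac{\pi(k-1)}{N}\right)\right),$$ and let $\mathbf{v}^{(k)}\in\mathbb{R}^N$ be the vector with components $$v^{(k)}_j=\sqrt{\frac{2-\delta_{k1}}{N}}\,\cos\left(\frac{\pi(k-1)\left(j-\frac12\right)}{N}\right),\qquad 1\le j\le N,$$ where $\delta_{k1}$ is the Kronecker delta. Let $\mathbf{U}=[\mathbf{v}^{(1)}|\cdots|\mathbf{v}^{(N)}]$ and $\mathbf{D}(t)=\operatorname{diag}(e^{-\lambda_1t},\dots,e^{-\lambda_Nt})$. Then for every $t\ge 0$ the transition matrix of heat diffusion on $P_N$ is $$\mathbf{T}(t)=e^{-t\mathbf{L}}=\mathbf{U}\mathbf{D}(t)\mathbf{U}^{\intercal},\qquad\text{i.e.}\qquad T_{i,j}(t)=\sum_{k=1}^N e^{-\lambda_kt}\,v^{(k)}_i v^{(k)}_j .$$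
   Context: The combinatorial Laplacian $\mathbf{L}$ of a graph with nodes $1,\dots,N$ has entries $L_{i,i}=d_i$ (the degree of node $i$), $L_{i,j}=-1$ if $i\neq j$ and $i,j$ are joined by an edge, and $L_{i,j}=0$ otherwise. Heat diffusion is the continuous-time homogeneous Markov chain on the nodes whose probability vector satisfies $\frac{d}{dt}\mathbf{p}^{\intercal}(t)=-\mathbf{p}^{\intercal}(t)\mathbf{L}$ (diffusion rate equal to 1), so its transition matrix over a time $t$ is $\mathbf{T}(t)=e^{-t\mathbf{L}}$. *)

theory Defs
  imports Complex_Main "Jordan_Normal_Form.Matrix"
begin

text \<open>
  Graphs have vertex set \<open>{1..N}\<close> and a set \<open>E\<close> of two-element edges.  Matrix and vector
  indices start at 0, so index \<open>i < N\<close> belongs to the vertex \<open>Suc i\<close>.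
\<close>

definition path_edges :: "nat \<Rightarrow> nat set set" where
  "path_edges N = {{i, i + 1} | i. 1 \<le> i \<and> i \<le> N - 1}"

definition degree :: "nat set set \<Rightarrow> nat \<Rightarrow> nat" where
  "degree E i = card {e \<in> E. i \<in> e}"

definition laplacian :: "nat \<Rightarrow> nat set set \<Rightarrow> real mat" where
  "laplacian N E = mat N N (\<lambda>(i, j).
     if i = j then real (degree E (Suc i))
     else if {Suc i, Suc j} \<in> E then - 1
     else 0)"

text \<open>The entrywise exponential series; it converges for every real square matrix.\<close>

definition mat_exp :: "real mat \<Rightarrow> real mat" where
  "mat_exp A = mat (dim_row A) (dim_row A) (\<lambda>(i, j). \<Sum>n. (A ^\<^sub>m n) $$ (i, j) / fact n)"

definition prob_vec :: "nat \<Rightarrow> real vec \<Rightarrow> bool" where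
  "prob_vec N p \<longleftrightarrow> p \<in> carrier_vec N \<and> (\<forall>i<N. 0 \<le> p $ i) \<and> (\<Sum>i<N. p $ i) = 1"

text \<open>
  Transition function of a continuous-time homogeneous Markov chain on \<open>N\<close> states;
  only the values at times \<open>t \<ge> 0\<close> matter.
\<close>

definition markov_transition :: "nat \<Rightarrow> (real \<Rightarrow> real mat) \<Rightarrow> bool" where
  "markov_transition N T \<longleftrightarrow>
     (\<forall>t\<ge>0. T t \<in> carrier_mat N N \<and> (\<forall>i<N. prob_vec N (row (T t) i))) \<and>
     T 0 = 1\<^sub>m N \<and>
     (\<forall>s\<ge>0. \<forall>t\<ge>0. T (s + t) = T s * T t)"

text \<open>
  Row vectors are represented by column vectors: \<open>p\<^sup>T M\<close> is \<open>transpose_mat M *\<^sub>v p\<close>.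
  At time 0 the derivative is one-sided.
\<close>

definition heat_equation :: "nat \<Rightarrow> nat set set \<Rightarrow> (real \<Rightarrow> real vec) \<Rightarrow> bool" where
  "heat_equation N E p \<longleftrightarrow>
     (\<forall>t\<ge>0. \<forall>j<N. ((\<lambda>s. p s $ j) has_real_derivative
        (- (transpose_mat (laplacian N E) *\<^sub>v p t)) $ j) (at t within {0..}))"

definition heat_diffusion_transition ::
    "nat \<Rightarrow> nat set set \<Rightarrow> (real \<Rightarrow> real mat) \<Rightarrow> bool" where
  "heat_diffusion_transition N E T \<longleftrightarrow>
     markov_transition N T \<and>
     (\<forall>p0. prob_vec N p0 \<longrightarrow> heat_equation N E (\<lambda>t. transpose_mat (T t) *\<^sub>v p0))"

definition path_eigval :: "nat \<Rightarrow> nat \<Rightarrow> real" where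
  "path_eigval N k = 2 * (1 - cos (pi * (real k - 1) / real N))"

text \<open>The component for vertex \<open>j\<close>, \<open>1 \<le> j \<le> N\<close>, of the \<open>k\<close>-th vector.\<close>

definition path_eigvec_comp :: "nat \<Rightarrow> nat \<Rightarrow> nat \<Rightarrow> real" where
  "path_eigvec_comp N k j =
     sqrt ((2 - (if k = 1 then 1 else 0)) / real N) *
     cos (pi * (real k - 1) * (real j - 1 / 2) / real N)"

definition path_eigvec :: "nat \<Rightarrow> nat \<Rightarrow> real vec" where
  "path_eigvec N k = vec N (\<lambda>j. path_eigvec_comp N k (Suc j))"

definition path_U :: "nat \<Rightarrow> real mat" where
  "path_U N = mat_of_cols N (map (path_eigvec N) [1..<N + 1])"

definition path_D :: "nat \<Rightarrow> real \<Rightarrow> real mat" where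
  "path_D N t = mat_diag N (\<lambda>k. exp (- path_eigval N (Suc k) * t))"

end

theory Submission
  imports Defs "Jordan_Normal_Form.Determinant"
begin

text \<open>
  The path Laplacian is the second difference operator with reflecting ends, so the functions
  \<open>cos (\<theta> (j + 1/2))\<close> that are symmetric about both half-integer reflection points
  \<open>- 1/2\<close> and \<open>N - 1/2\<close>, which is the case exactly for \<open>\<theta> = \<pi> k / N\<close>, are eigenvectors
  (\<open>cosine_neumann_eigenvector\<close>).  Products of cosines split into sums of cosines whose sum over
  the vertices telescopes, and this makes the normalized vectors orthonormal
  (\<open>path_U_orthogonal\<close>).

  Once \<open>L U = U diag(\<lambda>)\<close> with \<open>U\<close> orthogonal, powers of \<open>L\<close> are diagonalized by the same \<open>U\<close>, and
  summing the exponential series entry by entry gives \<open>exp (- t L) = U diag(exp (- \<lambda> t)) U\<^sup>T\<close>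
  (\<open>mat_exp_diagonalized\<close>).

  That this family is the one and only heat diffusion holds for every graph whose Laplacian is
  orthogonally diagonalized and has zero row sums (\<open>heat_diffusion_transition_iff\<close>).  Existence:
  the semigroup law and the heat equation are read off from the spectral form, unit row sums come
  from \<open>L 1 = 0\<close>, and nonnegativity from the sign of the off-diagonal entries of \<open>L\<close>, because adding a
  multiple of the identity makes \<open>- t L\<close> entrywise nonnegative at the cost of a positive scalar factor
  (\<open>exp_diagonalized_nonneg\<close>).  Uniqueness: row \<open>i\<close> of a transition matrix is the solution that
  starts in state \<open>i\<close>, and in the eigenbasis the heat equation decouples into scalar equations
  \<open>c' = - \<lambda> c\<close> (\<open>exp_decay_unique\<close>).
\<close>

section \<open>Functions of an orthogonally diagonalized matrix\<close>

lemma conj_diag_index: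
  fixes U :: "'a::comm_ring_1 mat"
  assumes U: "U \<in> carrier_mat N N" and "i < N" "j < N"
  shows "(U * mat_diag N g * transpose_mat U) $$ (i, j) = (\<Sum>k<N. g k * U $$ (i, k) * U $$ (j, k))"
  using assms
  by (auto simp: mat_diag_mult_right[OF U] scalar_prod_def atLeast0LessThan ac_simps intro!: sum.cong)

lemma orthogonal_rows:
  fixes U :: "'a::comm_ring_1 mat"
  assumes U: "U \<in> carrier_mat N N" and UU: "U * transpose_mat U = 1\<^sub>m N" and ij: "i < N" "j < N"
  shows "(\<Sum>k<N. U $$ (i, k) * U $$ (j, k)) = (if i = j then 1 else 0)"
proof -
  have "(U * transpose_mat U) $$ (i, j) = (\<Sum>k<N. U $$ (i, k) * U $$ (j, k))"
    using U ij by (auto simp: scalar_prod_def atLeast0LessThan intro!: sum.cong)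
  then show ?thesis using UU ij by simp
qed

text \<open>
  The hypothesis \<open>A U = U diag(a)\<close> is iterated before \<open>U\<close> is moved to the right-hand side, so
  that only \<open>U U\<^sup>T = 1\<close> is used.
\<close>

lemma pow_mat_diagonalized:
  fixes A U :: "'a::comm_ring_1 mat"
  assumes A: "A \<in> carrier_mat N N" and U: "U \<in> carrier_mat N N"
    and UU: "U * transpose_mat U = 1\<^sub>m N" and AU: "A * U = U * mat_diag N a"
  shows "A ^\<^sub>m n = U * mat_diag N (\<lambda>k. a k ^ n) * transpose_mat U"
proof -
  have "A ^\<^sub>m n * U = U * mat_diag N (\<lambda>k. a k ^ n)"
  proof (induction n)
    case 0
    then show ?case using A U by simp
  next
    case (Suc n)
    have "A ^\<^sub>m Suc n * U = A ^\<^sub>m n * (A * U)"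
      using A U by (simp add: assoc_mult_mat[of _ N N _ N _ N] mult_carrier_mat[of _ N N _ N])
    also have "\<dots> = (A ^\<^sub>m n * U) * mat_diag N a"
      using A U AU by (simp add: assoc_mult_mat[of _ N N _ N _ N] mult_carrier_mat[of _ N N _ N])
    also have "\<dots> = U * mat_diag N (\<lambda>k. a k ^ n * a k)"
      using U Suc by (simp add: assoc_mult_mat[of _ N N _ N _ N] mult_carrier_mat[of _ N N _ N])
    finally show ?case by (simp add: mult.commute)
  qed
  moreover have "A ^\<^sub>m n = A ^\<^sub>m n * U * transpose_mat U"
    using A U UU by (simp add: assoc_mult_mat[of _ N N _ N _ N] mult_carrier_mat[of _ N N _ N])
  ultimately show ?thesis by simp
qed

text \<open>
  Each entry of the exponential series is a finite combination of scalar exponential series.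
  Convergence is stated together with the value because \<open>mat_exp\<close> is defined by \<open>suminf\<close>, from
  which signs of terms cannot be transferred to the sum unless the series converges.
\<close>

lemma pow_mat_sums_exp:
  assumes A: "A \<in> carrier_mat N N" and U: "U \<in> carrier_mat N N"
    and UU: "U * transpose_mat U = 1\<^sub>m N" and AU: "A * U = U * mat_diag N a"
    and ij: "i < N" "j < N"
  shows "(\<lambda>n. (A ^\<^sub>m n) $$ (i, j) / fact n) sums
           (\<Sum>k<N. exp (a k :: real) * U $$ (i, k) * U $$ (j, k))"
proof -
  have "(\<lambda>n. \<Sum>k<N. (a k ^ n /\<^sub>R fact n) * (U $$ (i, k) * U $$ (j, k))) sums
          (\<Sum>k<N. exp (a k) * (U $$ (i, k) * U $$ (j, k)))"
    by (intro sums_sum sums_mult2 exp_converges)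
  moreover have "(A ^\<^sub>m n) $$ (i, j) / fact n =
      (\<Sum>k<N. (a k ^ n /\<^sub>R fact n) * (U $$ (i, k) * U $$ (j, k)))" for n
    unfolding pow_mat_diagonalized[OF A U UU AU] conj_diag_index[OF U ij] sum_divide_distrib
    by (intro sum.cong) (auto simp: field_simps)
  ultimately show ?thesis by (simp add: mult.assoc)
qed

lemma mat_exp_diagonalized:
  assumes A: "A \<in> carrier_mat N N" and U: "U \<in> carrier_mat N N"
    and UU: "U * transpose_mat U = 1\<^sub>m N" and AU: "A * U = U * mat_diag N a"
  shows "mat_exp A = U * mat_diag N (\<lambda>k. exp (a k)) * transpose_mat U"
proof (rule eq_matI)
  fix i j
  assume "i < dim_row (U * mat_diag N (\<lambda>k. exp (a k)) * transpose_mat U)"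
    and "j < dim_col (U * mat_diag N (\<lambda>k. exp (a k)) * transpose_mat U)"
  then have ij: "i < N" "j < N" using U by auto
  then have "mat_exp A $$ (i, j) = (\<Sum>n. (A ^\<^sub>m n) $$ (i, j) / fact n)"
    using A by (simp add: mat_exp_def)
  then show "mat_exp A $$ (i, j) = (U * mat_diag N (\<lambda>k. exp (a k)) * transpose_mat U) $$ (i, j)"
    using pow_mat_sums_exp[OF A U UU AU ij] conj_diag_index[OF U ij]
    by (simp add: sums_unique[symmetric])
qed (use A U in \<open>auto simp: mat_exp_def\<close>)

lemma smult_diagonalized:
  fixes A U :: "'a::comm_ring_1 mat"
  assumes A: "A \<in> carrier_mat N N" and U: "U \<in> carrier_mat N N"
    and AU: "A * U = U * mat_diag N a"
  shows "(c \<cdot>\<^sub>m A) * U = U * mat_diag N (\<lambda>k. c * a k)"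
  using A U AU
  by (auto simp: mult_smult_assoc_mat[OF A U] mat_diag_mult_right[OF U] algebra_simps intro!: eq_matI)

section \<open>Positivity of the exponential\<close>

lemma pow_mat_nonneg:
  fixes A :: "real mat"
  assumes A: "A \<in> carrier_mat N N" and nn: "\<And>i j. i < N \<Longrightarrow> j < N \<Longrightarrow> 0 \<le> A $$ (i, j)"
    and "i < N" "j < N"
  shows "0 \<le> (A ^\<^sub>m n) $$ (i, j)"
  using assms(3,4)
proof (induction n arbitrary: i j)
  case 0
  then show ?case using A by simp
next
  case (Suc n)
  have "(A ^\<^sub>m Suc n) $$ (i, j) = (\<Sum>l<N. (A ^\<^sub>m n) $$ (i, l) * A $$ (l, j))"
    using A Suc.prems pow_carrier_mat[OF A, of n]
    by (auto simp: scalar_prod_def atLeast0LessThan intro!: sum.cong)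
  then show ?case using Suc nn by (auto intro!: sum_nonneg)
qed

text \<open>
  The spectral form has terms of both signs.  Shifting \<open>A\<close> to \<open>A + c I\<close> keeps the eigenvectors and
  multiplies the sum by \<open>exp c > 0\<close>, and when \<open>A + c I\<close> is entrywise nonnegative so are all terms
  of its exponential series.
\<close>

lemma exp_diagonalized_nonneg:
  fixes A U :: "real mat"
  assumes A: "A \<in> carrier_mat N N" and U: "U \<in> carrier_mat N N"
    and UU: "U * transpose_mat U = 1\<^sub>m N" and AU: "A * U = U * mat_diag N a"
    and off: "\<And>i j. i < N \<Longrightarrow> j < N \<Longrightarrow> i \<noteq> j \<Longrightarrow> 0 \<le> A $$ (i, j)"
    and ij: "i < N" "j < N"
  shows "0 \<le> (\<Sum>k<N. exp (a k) * U $$ (i, k) * U $$ (j, k))"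
proof -
  \<comment> \<open>any upper bound for the moduli of the diagonal entries would do as the shift\<close>
  define c where "c = (\<Sum>l<N. \<bar>A $$ (l, l)\<bar>)"
  define M where "M = A + c \<cdot>\<^sub>m 1\<^sub>m N"
  have M: "M \<in> carrier_mat N N" using A by (simp add: M_def)
  have "M * U = A * U + c \<cdot>\<^sub>m U"
    using A U by (simp add: M_def add_mult_distrib_mat[of _ N N _ _ N] mult_smult_assoc_mat[of _ N N _ N])
  also have "\<dots> = U * mat_diag N (\<lambda>k. a k + c)"
    unfolding AU using U by (auto simp: mat_diag_mult_right[OF U] algebra_simps intro!: eq_matI)
  finally have MU: "M * U = U * mat_diag N (\<lambda>k. a k + c)" .
  have diag: "- A $$ (l, l) \<le> c" if "l < N" for l
  proof -
    have "\<bar>A $$ (l, l)\<bar> \<le> c"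
      unfolding c_def using that by (intro member_le_sum) auto
    then show ?thesis by simp
  qed
  have nn: "0 \<le> M $$ (p, q)" if "p < N" "q < N" for p q
    using that off[of p q] diag[of p] A by (cases "p = q") (auto simp: M_def)
  have "0 \<le> (\<Sum>k<N. exp (a k + c) * U $$ (i, k) * U $$ (j, k))"
  proof (rule sums_le[OF _ sums_zero pow_mat_sums_exp[OF M U UU MU ij]])
    show "0 \<le> (M ^\<^sub>m n) $$ (i, j) / fact n" for n
      using pow_mat_nonneg[OF M nn ij] by simp
  qed
  also have "\<dots> = exp c * (\<Sum>k<N. exp (a k) * U $$ (i, k) * U $$ (j, k))"
    by (simp add: sum_distrib_left exp_add ac_simps)
  finally show ?thesis by (simp add: zero_le_mult_iff not_le)
qed

section \<open>Heat diffusion on a graph with a diagonalized Laplacian\<close>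

lemma laplacian_symmetric:
  "i < N \<Longrightarrow> j < N \<Longrightarrow> laplacian N E $$ (i, j) = laplacian N E $$ (j, i)"
  by (simp add: laplacian_def insert_commute)

text \<open>
  The integrating factor \<open>exp (a t)\<close> turns the equation into the vanishing of a derivative.  The
  derivative is one-sided at 0, as in \<open>heat_equation\<close>; continuity there suffices for the mean value
  theorem.
\<close>

lemma exp_decay_unique:
  fixes c :: "real \<Rightarrow> real"
  assumes d: "\<And>t. 0 \<le> t \<Longrightarrow> (c has_real_derivative - a * c t) (at t within {0..})" and t: "0 \<le> t"
  shows "c t = exp (- a * t) * c 0"
proof (cases "t = 0")
  case False
  define g where "g s = exp (a * s) * c s" for s
  have g: "(g has_real_derivative 0) (at s within {0..})" if "0 \<le> s" for s
    unfolding g_def using d[OF that] by (auto intro!: derivative_eq_intros)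
  have "g t = g 0"
  proof (rule DERIV_isconst_end[where f = g])
    show "0 < t" using t False by simp
    have "continuous_on {0..} g"
      using g by (auto simp: continuous_on_eq_continuous_within intro: DERIV_continuous)
    then show "continuous_on {0..t} g" by (rule continuous_on_subset) auto
  next
    fix s :: real assume s: "0 < s" "s < t"
    then have "at s within {0..} = at s" by (intro at_within_open_subset[where S = "{0<..}"]) auto
    then show "DERIV g s :> 0" using g[of s] s by simp
  qed
  then show ?thesis by (simp add: g_def exp_minus field_simps)
qed simp

text \<open>
  The spectral family \<open>X t\<close> is a heat diffusion, and every heat diffusion agrees with it on
  \<open>t \<ge> 0\<close>.  Uniqueness tests the heat equation only at the initial distributions concentrated in
  one state; their orbits are the rows of \<open>T t\<close>.
\<close>

lemma heat_diffusion_transition_iff: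
  assumes U: "U \<in> carrier_mat N N" and UU: "U * transpose_mat U = 1\<^sub>m N"
    and LU: "laplacian N E * U = U * mat_diag N lam"
    and rows: "\<And>i. i < N \<Longrightarrow> (\<Sum>j<N. laplacian N E $$ (i, j)) = 0"
  shows "heat_diffusion_transition N E T \<longleftrightarrow>
           (\<forall>t\<ge>0. T t = U * mat_diag N (\<lambda>k. exp (- lam k * t)) * transpose_mat U)"
proof -
  define L where "L = laplacian N E"
  define X where "X t = U * mat_diag N (\<lambda>k. exp (- lam k * t)) * transpose_mat U" for t
  have L: "L \<in> carrier_mat N N" by (simp add: L_def laplacian_def)
  have X: "X t \<in> carrier_mat N N" for t using U by (simp add: X_def mult_carrier_mat[of _ N N])
  have Xij: "X t $$ (i, j) = (\<Sum>k<N. exp (- lam k * t) * U $$ (i, k) * U $$ (j, k))"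
    if "i < N" "j < N" for t i j
    unfolding X_def by (rule conj_diag_index[OF U that])
  have UtU: "transpose_mat U * U = 1\<^sub>m N"
    using mat_mult_left_right_inverse[OF U _ UU] U by simp
  have eig: "(\<Sum>l<N. L $$ (l, j) * U $$ (l, k)) = lam k * U $$ (j, k)" if "j < N" "k < N" for j k
  proof -
    have "(\<Sum>l<N. L $$ (l, j) * U $$ (l, k)) = (L * U) $$ (j, k)"
      using L U that laplacian_symmetric[of _ N j E]
      by (auto simp: scalar_prod_def atLeast0LessThan L_def intro!: sum.cong)
    also have "\<dots> = lam k * U $$ (j, k)"
      using U that by (simp add: L_def LU mat_diag_mult_right[OF U])
    finally show ?thesis .
  qed
  have vec_index: "(transpose_mat B *\<^sub>v p) $ j = (\<Sum>i<N. p $ i * B $$ (i, j))"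
    if "B \<in> carrier_mat N N" "p \<in> carrier_vec N" "j < N" for B :: "real mat" and p j
    using that by (auto simp: scalar_prod_def atLeast0LessThan ac_simps intro!: sum.cong)
  have neg_index: "(- (transpose_mat L *\<^sub>v v)) $ j = - (\<Sum>l<N. v $ l * L $$ (l, j))"
    if "v \<in> carrier_vec N" "j < N" for v j
    using L that vec_index[OF L that] by (simp del: index_mult_mat_vec)

  \<comment> \<open>The all-ones vector has components \<open>w k\<close> in the eigenbasis; they are supported on the kernel
    of \<open>L\<close>, where the exponential factors are 1.\<close>
  have rowsum: "(\<Sum>j<N. X t $$ (i, j)) = 1" if i: "i < N" for i t
  proof -
    define w where "w k = (\<Sum>j<N. U $$ (j, k))" for k
    have w: "exp (- lam k * t) * w k = w k" if k: "k < N" for k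
    proof -
      have "lam k * w k = (\<Sum>j<N. \<Sum>l<N. L $$ (l, j) * U $$ (l, k))"
        using k by (simp add: w_def sum_distrib_left eig)
      also have "\<dots> = (\<Sum>l<N. (\<Sum>j<N. L $$ (l, j)) * U $$ (l, k))"
        by (subst sum.swap) (simp add: sum_distrib_right)
      also have "\<dots> = 0" using rows by (simp add: L_def)
      finally show ?thesis by auto
    qed
    have expand: "(\<Sum>j<N. \<Sum>k<N. g k * U $$ (i, k) * U $$ (j, k)) = (\<Sum>k<N. U $$ (i, k) * (g k * w k))"
      for g
      by (subst sum.swap) (simp add: w_def sum_distrib_left ac_simps)
    have "(\<Sum>j<N. X t $$ (i, j)) = (\<Sum>k<N. U $$ (i, k) * (exp (- lam k * t) * w k))"
      using i by (simp add: Xij expand)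
    also have "\<dots> = (\<Sum>k<N. U $$ (i, k) * (1 * w k))"
      by (rule sum.cong) (simp_all only: w lessThan_iff mult_1_left)
    also have "\<dots> = (\<Sum>j<N. if i = j then 1 else 0)"
      unfolding expand[symmetric] using orthogonal_rows[OF U UU i] by simp
    finally show ?thesis using i by simp
  qed

  have nonneg: "0 \<le> X t $$ (i, j)" if "0 \<le> t" "i < N" "j < N" for t i j
  proof -
    have "0 \<le> ((- t) \<cdot>\<^sub>m L) $$ (p, q)" if "p < N" "q < N" "p \<noteq> q" for p q
      using that \<open>0 \<le> t\<close> by (simp add: L_def laplacian_def)
    from exp_diagonalized_nonneg[OF _ U UU smult_diagonalized[OF L U] this that(2,3)]
    show ?thesis using L LU that by (simp add: Xij L_def mult.commute)
  qed

  have markov: "markov_transition N X"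
    unfolding markov_transition_def
  proof (intro conjI allI impI)
    show "X 0 = 1\<^sub>m N" using U UU by (simp add: X_def)
    show "X (s + t) = X s * X t" for s t
    proof -
      have "X s * X t = U * mat_diag N (\<lambda>k. exp (- lam k * s)) * (transpose_mat U * U) *
          mat_diag N (\<lambda>k. exp (- lam k * t)) * transpose_mat U"
        using U by (simp add: X_def assoc_mult_mat[of _ N N _ N _ N] mult_carrier_mat[of _ N N _ N])
      also have "\<dots> = U * (mat_diag N (\<lambda>k. exp (- lam k * s)) * mat_diag N (\<lambda>k. exp (- lam k * t))) *
          transpose_mat U"
        using U UtU by (simp add: assoc_mult_mat[of _ N N _ N _ N] mult_carrier_mat[of _ N N _ N]
            left_mult_one_mat[of _ N N] del: mat_diag_diag)
      also have "\<dots> = X (s + t)"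
        by (simp add: X_def exp_add[symmetric] algebra_simps)
      finally show ?thesis ..
    qed
    show "prob_vec N (row (X t) i)" if "0 \<le> t" "i < N" for t i
      using X[of t] that nonneg rowsum by (auto simp: prob_vec_def)
  qed (rule X)

  have heat: "heat_equation N E (\<lambda>t. transpose_mat (X t) *\<^sub>v p)" if p: "prob_vec N p" for p
    unfolding heat_equation_def
  proof (intro allI impI)
    fix t :: real and j assume j: "j < N"
    have pc: "p \<in> carrier_vec N" using p by (simp add: prob_vec_def)
    \<comment> \<open>coordinates of the initial distribution in the eigenbasis\<close>
    define c where "c k = (\<Sum>i<N. p $ i * U $$ (i, k))" for k
    have q: "(transpose_mat (X s) *\<^sub>v p) $ l = (\<Sum>k<N. exp (- lam k * s) * U $$ (l, k) * c k)"
      if l: "l < N" for s l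
    proof -
      have "(transpose_mat (X s) *\<^sub>v p) $ l =
          (\<Sum>i<N. \<Sum>k<N. p $ i * (exp (- lam k * s) * U $$ (i, k) * U $$ (l, k)))"
        unfolding vec_index[OF X pc l] using l by (simp add: Xij sum_distrib_left)
      then show ?thesis
        by (subst (asm) sum.swap) (simp add: c_def sum_distrib_left ac_simps)
    qed
    have "(- (transpose_mat L *\<^sub>v (transpose_mat (X t) *\<^sub>v p))) $ j =
        - (\<Sum>l<N. \<Sum>k<N. exp (- lam k * t) * U $$ (l, k) * c k * L $$ (l, j))"
      using X[of t] pc j by (simp add: neg_index q sum_distrib_right del: index_mult_mat_vec)
    also have "\<dots> = - (\<Sum>k<N. exp (- lam k * t) * c k * (\<Sum>l<N. L $$ (l, j) * U $$ (l, k)))"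
      by (subst sum.swap) (simp add: sum_distrib_left ac_simps)
    also have "\<dots> = (\<Sum>k<N. - lam k * exp (- lam k * t) * U $$ (j, k) * c k)"
      using j by (simp add: eig sum_negf ac_simps)
    finally have rhs: "(- (transpose_mat L *\<^sub>v (transpose_mat (X t) *\<^sub>v p))) $ j =
        (\<Sum>k<N. - lam k * exp (- lam k * t) * U $$ (j, k) * c k)" .
    have "((\<lambda>s. \<Sum>k<N. exp (- lam k * s) * U $$ (j, k) * c k) has_real_derivative
        (\<Sum>k<N. - lam k * exp (- lam k * t) * U $$ (j, k) * c k)) (at t within {0..})"
      by (auto intro!: derivative_eq_intros sum.cong)
    then show "((\<lambda>s. (transpose_mat (X s) *\<^sub>v p) $ j) has_real_derivative
        (- (transpose_mat (laplacian N E) *\<^sub>v (transpose_mat (X t) *\<^sub>v p))) $ j) (at t within {0..})"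
      unfolding q[OF j] rhs[unfolded L_def] .
  qed

  have unique: "T t = X t" if T: "heat_diffusion_transition N E T" and t: "0 \<le> t" for t
  proof -
    have Tc: "T s \<in> carrier_mat N N" if "0 \<le> s" for s
      using T that by (simp add: heat_diffusion_transition_def markov_transition_def)
    have coeff: "(\<Sum>j<N. T t $$ (i, j) * U $$ (j, k)) = exp (- lam k * t) * U $$ (i, k)"
      if i: "i < N" and k: "k < N" for i k
    proof -
      have "prob_vec N (unit_vec N i)"
        using i by (auto simp: prob_vec_def)
      then have ode: "((\<lambda>s. (transpose_mat (T s) *\<^sub>v unit_vec N i) $ j) has_real_derivative
          (- (transpose_mat L *\<^sub>v (transpose_mat (T s) *\<^sub>v unit_vec N i))) $ j) (at s within {0..})"
        if "0 \<le> s" "j < N" for s j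
        using T that unfolding heat_diffusion_transition_def heat_equation_def L_def by blast
      have Tij: "(transpose_mat (T s) *\<^sub>v unit_vec N i) $ j = T s $$ (i, j)" if "0 \<le> s" "j < N" for s j
        using Tc[of s] i that by simp
      have d: "((\<lambda>s. T s $$ (i, j)) has_real_derivative - (\<Sum>l<N. T s $$ (i, l) * L $$ (l, j)))
          (at s within {0..})" if s: "0 \<le> s" and j: "j < N" for s j
      proof -
        have "(- (transpose_mat L *\<^sub>v (transpose_mat (T s) *\<^sub>v unit_vec N i))) $ j =
            - (\<Sum>l<N. T s $$ (i, l) * L $$ (l, j))"
          using Tc[OF s] s j by (simp add: neg_index Tij del: index_mult_mat_vec)
        with ode[OF s j] have "((\<lambda>s. (transpose_mat (T s) *\<^sub>v unit_vec N i) $ j) has_real_derivative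
            - (\<Sum>l<N. T s $$ (i, l) * L $$ (l, j))) (at s within {0..})" by simp
        then show ?thesis
          by (rule has_field_derivative_transform_within[where d = 1]) (use s j Tij in auto)
      qed
      \<comment> \<open>coordinates of row \<open>i\<close> in the eigenbasis, in which the system decouples\<close>
      define c where "c s = (\<Sum>j<N. T s $$ (i, j) * U $$ (j, k))" for s
      have decay: "(c has_real_derivative - lam k * c s) (at s within {0..})" if s: "0 \<le> s" for s
      proof -
        have "(c has_real_derivative (\<Sum>j<N. - (\<Sum>l<N. T s $$ (i, l) * L $$ (l, j)) * U $$ (j, k)))
            (at s within {0..})"
          unfolding c_def using d[OF s] by (auto intro!: derivative_eq_intros)
        also have "(\<Sum>j<N. - (\<Sum>l<N. T s $$ (i, l) * L $$ (l, j)) * U $$ (j, k)) =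
            - (\<Sum>j<N. \<Sum>l<N. T s $$ (i, l) * L $$ (l, j) * U $$ (j, k))"
          by (simp add: sum_negf sum_distrib_right)
        also have "(\<Sum>j<N. \<Sum>l<N. T s $$ (i, l) * L $$ (l, j) * U $$ (j, k)) =
            (\<Sum>l<N. T s $$ (i, l) * (\<Sum>j<N. L $$ (j, l) * U $$ (j, k)))"
          by (subst sum.swap)
            (auto simp: sum_distrib_left L_def laplacian_symmetric[of _ N] ac_simps intro!: sum.cong)
        also have "\<dots> = lam k * c s"
          using k by (simp add: eig c_def sum_distrib_left ac_simps)
        finally show ?thesis by simp
      qed
      have "c t = exp (- lam k * t) * c 0" by (rule exp_decay_unique[OF decay t])
      moreover have "T 0 = 1\<^sub>m N"
        using T by (simp add: heat_diffusion_transition_def markov_transition_def)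
      then have "c 0 = (\<Sum>j<N. if j = i then U $$ (j, k) else 0)"
        unfolding c_def using i by (intro sum.cong) auto
      then have "c 0 = U $$ (i, k)" using i by simp
      ultimately show ?thesis by (simp add: c_def)
    qed
    have "T t * U = U * mat_diag N (\<lambda>k. exp (- lam k * t))"
      using Tc[OF t] U coeff
      by (intro eq_matI)
        (auto simp: mat_diag_mult_right[OF U] scalar_prod_def atLeast0LessThan mult.commute)
    then have "T t * (U * transpose_mat U) = X t"
      using Tc[OF t] U by (simp add: X_def assoc_mult_mat[of _ N N _ N _ N, symmetric] mult_carrier_mat[of _ N N _ N])
    then show ?thesis using Tc[OF t] UU by simp
  qed

  have "heat_diffusion_transition N E T" if eq: "\<And>t. 0 \<le> t \<Longrightarrow> T t = X t"
    unfolding heat_diffusion_transition_def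
  proof (intro conjI allI impI)
    show "markov_transition N T"
      using markov by (simp add: markov_transition_def eq)
    fix p assume p: "prob_vec N p"
    show "heat_equation N E (\<lambda>t. transpose_mat (T t) *\<^sub>v p)"
      unfolding heat_equation_def
    proof (intro allI impI)
      fix t :: real and j assume t: "0 \<le> t" and j: "j < N"
      from heat[OF p] t j have "((\<lambda>s. (transpose_mat (X s) *\<^sub>v p) $ j) has_real_derivative
          (- (transpose_mat (laplacian N E) *\<^sub>v (transpose_mat (T t) *\<^sub>v p))) $ j) (at t within {0..})"
        by (simp add: heat_equation_def eq)
      then show "((\<lambda>s. (transpose_mat (T s) *\<^sub>v p) $ j) has_real_derivative
          (- (transpose_mat (laplacian N E) *\<^sub>v (transpose_mat (T t) *\<^sub>v p))) $ j) (at t within {0..})"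
        by (rule has_field_derivative_transform_within[where d = 1]) (use t eq in auto)
    qed
  qed
  then show ?thesis using unique unfolding X_def by blast
qed

section \<open>Spectrum of the path Laplacian\<close>

lemma degree_path:
  assumes "i < N"
  shows "Defs.degree (path_edges N) (Suc i) = (if 0 < i then 1 else 0) + (if Suc i < N then 1 else 0)"
proof -
  have "{e \<in> path_edges N. Suc i \<in> e} =
      (if 0 < i then {{i, Suc i}} else {}) \<union> (if Suc i < N then {{Suc i, Suc (Suc i)}} else {})"
    using assms by (auto simp: path_edges_def)
  then show ?thesis
    by (auto simp: Defs.degree_def doubleton_eq_iff)
qed

lemma path_edge_iff:
  assumes "i < N" "j < N"
  shows "{Suc i, Suc j} \<in> path_edges N \<longleftrightarrow> j = Suc i \<or> i = Suc j"
  using assms by (auto simp: path_edges_def doubleton_eq_iff)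

text \<open>
  Written as differences to the existing neighbours, so that a missing neighbour at an end of the
  path acts like a neighbour with the same value: a reflecting boundary.
\<close>

lemma path_laplacian_apply:
  assumes i: "i < N"
  shows "(\<Sum>j<N. laplacian N (path_edges N) $$ (i, j) * x j) =
           (if 0 < i then x i - x (i - 1) else 0) + (if Suc i < N then x i - x (Suc i) else 0)"
proof -
  have "(\<Sum>j<N. laplacian N (path_edges N) $$ (i, j) * x j) =
      (\<Sum>j<N. (if j = i then real (Defs.degree (path_edges N) (Suc i)) * x i else 0) -
         (if j = Suc i then x j else 0) - (if j = i - 1 then if 0 < i then x j else 0 else 0))"
    using i by (intro sum.cong) (auto simp: laplacian_def path_edge_iff)
  also have "\<dots> = real (Defs.degree (path_edges N) (Suc i)) * x i -
      (if Suc i < N then x (Suc i) else 0) - (if 0 < i then x (i - 1) else 0)"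
    using i by (simp add: sum_subtractf)
  finally show ?thesis using i by (auto simp: degree_path algebra_simps)
qed

text \<open>
  Extended to all real arguments, the cosine satisfies the three-term recurrence everywhere and takes
  equal values at \<open>- 1\<close> and \<open>0\<close>, and at \<open>N - 1\<close> and \<open>N\<close>.  Hence the missing differences at the two
  ends may be added, since they are 0, and the interior computation covers all vertices.
\<close>

lemma cosine_neumann_eigenvector:
  fixes N k :: nat
  defines "\<theta> \<equiv> pi * real k / real N"
  assumes i: "i < N"
  shows "(\<Sum>j<N. laplacian N (path_edges N) $$ (i, j) * cos (\<theta> * (real j + 1 / 2))) =
           2 * (1 - cos \<theta>) * cos (\<theta> * (real i + 1 / 2))"
proof -
  define f where "f y = cos (\<theta> * (y + 1 / 2))" for y :: real
  have rec: "f (y - 1) + f (y + 1) = 2 * cos \<theta> * f y" for y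
  proof -
    have "f (y - 1) = cos (\<theta> * (y + 1 / 2) - \<theta>)" "f (y + 1) = cos (\<theta> * (y + 1 / 2) + \<theta>)"
      unfolding f_def by (simp_all add: algebra_simps)
    then show ?thesis by (simp add: cos_add cos_diff f_def)
  qed
  have left: "f (- 1) = f 0"
    unfolding f_def using cos_minus[of "\<theta> / 2"] by simp
  have right: "f (real N) = f (real N - 1)"
  proof -
    have "\<theta> * real N = real k * pi" using i by (simp add: \<theta>_def)
    then have "f (real N) = cos (real k * pi + \<theta> / 2)" "f (real N - 1) = cos (real k * pi - \<theta> / 2)"
      unfolding f_def by (simp_all add: algebra_simps)
    then show ?thesis by (simp add: cos_add cos_diff)
  qed
  have "(if 0 < i then f (real i) - f (real (i - 1)) else 0) = f (real i) - f (real i - 1)"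
    using left by (auto simp: of_nat_diff)
  moreover have "(if Suc i < N then f (real i) - f (real (Suc i)) else 0) = f (real i) - f (real i + 1)"
  proof (cases "Suc i < N")
    case False
    with i have "real N = real i + 1" by linarith
    with right False show ?thesis by simp
  qed (simp add: add.commute)
  ultimately show ?thesis
    using path_laplacian_apply[OF i, of "\<lambda>j. f (real j)"] rec[of "real i"]
    unfolding f_def[symmetric] by (simp add: algebra_simps)
qed

text \<open>
  The factor \<open>2 sin (\<theta>/2)\<close> makes the sum telescope:
  \<open>2 sin (\<theta>/2) cos (\<theta> (j + 1/2)) = sin ((j + 1) \<theta>) - sin (j \<theta>)\<close>.
\<close>

lemma sum_cos_half_integer:
  "2 * sin (\<theta> / 2) * (\<Sum>j<n. cos (\<theta> * (real j + 1 / 2))) = sin (real n * \<theta>)"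
proof (induction n)
  case (Suc n)
  have "sin (real (Suc n) * \<theta>) = sin (\<theta> * (real n + 1 / 2) + \<theta> / 2)"
    "sin (real n * \<theta>) = sin (\<theta> * (real n + 1 / 2) - \<theta> / 2)"
    by (simp_all add: algebra_simps)
  then have "sin (real (Suc n) * \<theta>) - sin (real n * \<theta>) = 2 * sin (\<theta> / 2) * cos (\<theta> * (real n + 1 / 2))"
    by (simp add: sin_add sin_diff)
  then show ?case using Suc by (simp add: algebra_simps)
qed simp

text \<open>
  The bound on \<open>m\<close> is what keeps \<open>sin (\<theta>/2)\<close> away from 0; both the sum and the difference of two
  indices below \<open>N\<close> satisfy it.
\<close>

lemma sum_cos_frequency_eq_0:
  fixes m :: int
  assumes "m \<noteq> 0" "\<bar>m\<bar> < 2 * int N"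
  shows "(\<Sum>j<N. cos (pi * real_of_int m / real N * (real j + 1 / 2))) = 0"
proof -
  let ?\<theta> = "pi * real_of_int m / real N"
  have N: "0 < N" using assms by auto
  have "sin (?\<theta> / 2) \<noteq> 0"
  proof
    assume "sin (?\<theta> / 2) = 0"
    then obtain q :: int where "?\<theta> / 2 = of_int q * pi" by (auto simp: sin_zero_iff_int2)
    then have "real_of_int m = real_of_int (2 * int N * q)" using N by (simp add: field_simps)
    then have m: "m = 2 * int N * q" by (simp only: of_int_eq_iff)
    with assms(1) have "1 \<le> \<bar>q\<bar>" by auto
    then have "2 * int N * 1 \<le> 2 * int N * \<bar>q\<bar>" by (intro mult_left_mono) auto
    with m assms(2) show False by (simp add: abs_mult)
  qed
  moreover have "sin (real N * ?\<theta>) = 0"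
    using N by (simp add: sin_zero_iff_int2 mult.commute)
  ultimately show ?thesis using sum_cos_half_integer[of ?\<theta> N] by simp
qed

lemma path_U_carrier: "path_U N \<in> carrier_mat N N"
  by (simp add: path_U_def mat_of_cols_def del: upt_Suc)

lemma path_U_index:
  assumes "i < N" "k < N"
  shows "path_U N $$ (i, k) = path_eigvec_comp N (Suc k) (Suc i)"
  using assms by (simp add: path_U_def mat_of_cols_def path_eigvec_def del: upt_Suc)

lemma path_U_cos:
  assumes "i < N" "k < N"
  shows "path_U N $$ (i, k) =
    sqrt ((if k = 0 then 1 else 2) / real N) * cos (pi * real k / real N * (real i + 1 / 2))"
  using assms by (simp add: path_U_index path_eigvec_comp_def add.commute)

text \<open>
  The trigonometric sums give orthonormal columns, that is \<open>U\<^sup>T U = 1\<close>; for a square matrix the other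
  product is then 1 as well.
\<close>

lemma path_U_orthogonal: "path_U N * transpose_mat (path_U N) = 1\<^sub>m N"
proof -
  let ?U = "path_U N"
  note U = path_U_carrier[of N]
  have orth: "(\<Sum>j<N. ?U $$ (j, a) * ?U $$ (j, b)) = (if a = b then 1 else 0)"
    if ab: "a < N" "b < N" for a b
  proof -
    define C where "C m = (\<Sum>j<N. cos (pi * real_of_int m / real N * (real j + 1 / 2)))" for m
    have C: "C m = (if m = 0 then real N else 0)" if "\<bar>m\<bar> < 2 * int N" for m
      using sum_cos_frequency_eq_0[OF _ that] by (simp add: C_def)
    let ?c = "\<lambda>k. sqrt ((if k = 0 then 1 else 2) / real N)"
    have "(\<Sum>j<N. ?U $$ (j, a) * ?U $$ (j, b)) = ?c a * ?c b *
        (\<Sum>j<N. cos (pi * real a / real N * (real j + 1 / 2)) * cos (pi * real b / real N * (real j + 1 / 2)))"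
      unfolding sum_distrib_left using ab by (intro sum.cong) (simp_all add: path_U_cos)
    also have "(\<Sum>j<N. cos (pi * real a / real N * (real j + 1 / 2)) * cos (pi * real b / real N * (real j + 1 / 2)))
        = (C (int a - int b) + C (int a + int b)) / 2"
      unfolding C_def sum.distrib[symmetric] sum_divide_distrib cos_times_cos
      by (intro sum.cong) (simp_all add: algebra_simps diff_divide_distrib add_divide_distrib)
    also have "\<dots> = (if a = b then if a = 0 then real N else real N / 2 else 0)"
      using ab by (subst (1 2) C) auto
    finally show ?thesis using ab by (auto simp: real_sqrt_mult_self)
  qed
  have "transpose_mat ?U * ?U = 1\<^sub>m N"
    using U orth by (intro eq_matI) (auto simp: scalar_prod_def atLeast0LessThan)
  then show ?thesis using mat_mult_left_right_inverse[of "transpose_mat ?U" N ?U] U by simp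
qed

lemma path_laplacian_diagonalized:
  "laplacian N (path_edges N) * path_U N = path_U N * mat_diag N (\<lambda>k. path_eigval N (Suc k))"
proof (rule eq_matI)
  note U = path_U_carrier[of N]
  fix i k assume "i < dim_row (path_U N * mat_diag N (\<lambda>k. path_eigval N (Suc k)))"
    "k < dim_col (path_U N * mat_diag N (\<lambda>k. path_eigval N (Suc k)))"
  then have ik: "i < N" "k < N" using U by (auto simp: mat_diag_mult_right[OF U])
  let ?s = "sqrt ((if k = 0 then 1 else 2) / real N)"
  have "(laplacian N (path_edges N) * path_U N) $$ (i, k) =
      (\<Sum>j<N. laplacian N (path_edges N) $$ (i, j) * path_U N $$ (j, k))"
    using U ik by (auto simp: scalar_prod_def atLeast0LessThan laplacian_def intro!: sum.cong)
  also have "\<dots> = ?s * (\<Sum>j<N. laplacian N (path_edges N) $$ (i, j) * cos (pi * real k / real N * (real j + 1 / 2)))"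
    unfolding sum_distrib_left using ik by (intro sum.cong) (simp_all add: path_U_cos)
  also have "\<dots> = path_U N $$ (i, k) * path_eigval N (Suc k)"
    unfolding cosine_neumann_eigenvector[OF ik(1)] using ik by (simp add: path_U_cos path_eigval_def)
  finally show "(laplacian N (path_edges N) * path_U N) $$ (i, k) =
      (path_U N * mat_diag N (\<lambda>k. path_eigval N (Suc k))) $$ (i, k)"
    using ik by (simp add: mat_diag_mult_right[OF U])
qed (use path_U_carrier[of N] in \<open>auto simp: laplacian_def mat_diag_mult_right[OF path_U_carrier]\<close>)

section \<open>The heat kernel of the path\<close>

theorem mainTheorem4:
  fixes N :: nat
  assumes "N \<ge> 2"
  shows "(\<forall>T. heat_diffusion_transition N (path_edges N) T \<longleftrightarrow>
            (\<forall>t\<ge>0. T t = mat_exp ((- t) \<cdot>\<^sub>m laplacian N (path_edges N)))) \<and>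
         (\<forall>t\<ge>0.
            mat_exp ((- t) \<cdot>\<^sub>m laplacian N (path_edges N)) =
              path_U N * path_D N t * transpose_mat (path_U N) \<and>
            (\<forall>i\<in>{1..N}. \<forall>j\<in>{1..N}.
              mat_exp ((- t) \<cdot>\<^sub>m laplacian N (path_edges N)) $$ (i - 1, j - 1) =
                (\<Sum>k=1..N. exp (- path_eigval N k * t) *
                   path_eigvec_comp N k i * path_eigvec_comp N k j)))"
proof -
  let ?L = "laplacian N (path_edges N)"
  note U = path_U_carrier[of N]
  have L: "?L \<in> carrier_mat N N" by (simp add: laplacian_def)
  have expL: "mat_exp ((- t) \<cdot>\<^sub>m ?L) = path_U N * path_D N t * transpose_mat (path_U N)" for t
    using mat_exp_diagonalized[OF _ U path_U_orthogonal
        smult_diagonalized[OF L U path_laplacian_diagonalized]] L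
    by (simp add: path_D_def mult.commute)
  have rows: "(\<Sum>j<N. ?L $$ (i, j)) = 0" if "i < N" for i
    using path_laplacian_apply[OF that, of "\<lambda>_. 1"] by simp
  have iff: "heat_diffusion_transition N (path_edges N) T \<longleftrightarrow> (\<forall>t\<ge>0. T t = mat_exp ((- t) \<cdot>\<^sub>m ?L))" for T
    using heat_diffusion_transition_iff[OF U path_U_orthogonal path_laplacian_diagonalized rows]
    by (simp add: expL path_D_def)
  have entry: "mat_exp ((- t) \<cdot>\<^sub>m ?L) $$ (i - 1, j - 1) =
      (\<Sum>k=1..N. exp (- path_eigval N k * t) * path_eigvec_comp N k i * path_eigvec_comp N k j)"
    if "i \<in> {1..N}" "j \<in> {1..N}" for t i j
  proof -
    have ij: "i - 1 < N" "j - 1 < N" using that by auto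
    have "mat_exp ((- t) \<cdot>\<^sub>m ?L) $$ (i - 1, j - 1) = (\<Sum>k<N. exp (- path_eigval N (Suc k) * t) *
        path_eigvec_comp N (Suc k) i * path_eigvec_comp N (Suc k) j)"
      unfolding expL path_D_def conj_diag_index[OF U ij]
      using that ij by (intro sum.cong) (auto simp: path_U_index)
    also have "\<dots> = (\<Sum>k=1..N. exp (- path_eigval N k * t) *
        path_eigvec_comp N k i * path_eigvec_comp N k j)"
      by (simp only: One_nat_def sum.atLeast1_atMost_eq)
    finally show ?thesis .
  qed
  show ?thesis using iff expL entry by blast
qed

end
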